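(* Let $p$ be a prime number, let $1 \leq e_1 \leq \cdots \leq e_n$ be integers, and let $H_p = \mathbb{Z}/p^{e_1}\mathbb{Z} \times \cdots \times \mathbb{Z}/p^{e_n}\mathbb{Z}$. Let $A \in R_p$ and let $M = \psi(A) \in \mathrm{End}(H_p)$. Then the endomorphism $M$ is an automorphism of $H_p$ if and only if $A \ (\mathrm{mod}\ p) \in \mathrm{GL}_n(\mathbb{F}_p)$.
   Context: $\mathbb{F}_p = \mathbb{Z}/p\mathbb{Z}$, and $A \ (\mathrm{mod}\ p)$ is the matrix over $\mathbb{F}_p$ obtained by reducing every entry of $A$ modulo $p$. $R_p$ is the ring of integer matrices \[R_p = \left\{ (a_{ij}) \in \mathbb{Z}^{n \times n} : p^{e_i-e_j} \mid a_{ij} \text{ for all } i,j \text{ satisfying } 1 \leq j \leq i \leq n\right\}\] under the usual matrix addition and multiplication. Elements of $H_p$ are written as column vectors $(\overline{h}_1,\ldots,\overline{h}_n)^T$ with $\overline{h}_i \in \mathbb{Z}/p^{e_i}\mathbb{Z}$. The map $\pi: \mathbb{Z}^n \to H_p$ is the group homomorphism $\pi(h_1,\ldots,h_n)^T = (\overline{h}_1,\ldots,\overline{h}_n)^T$, where $\overline{h}_i$ is the class of $h_i$ modulo $p^{e_i}$. $\mathrm{End}(H_p)$ is the ring of group endomorphisms of $H_p$ (pointwise addition, composition as multiplication). The map $\psi: R_p \to \mathrm{End}(H_p)$ is the surjective ring homomorphism given by $\psi(A)(\overline{h}_1,\ldots,\overline{h}_n)^T = \pi\left(A(h_1,\ldots,h_n)^T\right)$,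 where $h_i\in\mathbb{Z}$ is any integer representative of $\overline{h}_i$ (this is well defined). *)

theory Defs
  imports
    "HOL-Algebra.Bij"
    "HOL-Algebra.Elementary_Groups"
    "HOL-Algebra.Product_Groups"
    "Jordan_Normal_Form.Matrix"
    "Berlekamp_Zassenhaus.Finite_Field"
begin

text \<open>
  Rows, columns and exponents are indexed by \<open>0, \<dots>, n - 1\<close>, following the matrix library, so
  \<open>e i\<close> is the exponent usually written with index \<open>i + 1\<close>.  Elements of \<open>Hp p e n\<close> are
  extensional functions on \<open>{..<n}\<close> whose value at \<open>i\<close> is the representative in
  \<open>{0..<p ^ e i}\<close> of the residue class; the group operation, written multiplicatively by
  the library, is componentwise addition modulo \<open>p ^ e i\<close>.
\<close>

definition Hp :: "nat \<Rightarrow> (nat \<Rightarrow> nat) \<Rightarrow> nat \<Rightarrow> (nat \<Rightarrow> int) monoid"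
  where "Hp p e n = product_group {..<n} (\<lambda>i. integer_mod_group (p ^ e i))"

text \<open>
  The exponents are used with \<open>e\<close> nondecreasing on \<open>{..<n}\<close>; then the subtraction
  below does not truncate.
\<close>

definition Rp :: "nat \<Rightarrow> (nat \<Rightarrow> nat) \<Rightarrow> nat \<Rightarrow> int mat set"
  where "Rp p e n =
    {A \<in> carrier_mat n n. \<forall>i<n. \<forall>j\<le>i. int p ^ (e i - e j) dvd A $$ (i, j)}"

definition proj_Hp :: "nat \<Rightarrow> (nat \<Rightarrow> nat) \<Rightarrow> nat \<Rightarrow> int vec \<Rightarrow> (nat \<Rightarrow> int)"
  where "proj_Hp p e n h = (\<lambda>i\<in>{..<n}. h $ i mod int (p ^ e i))"

text \<open>
  \<open>vec n x\<close> is the integer vector of the canonical representatives of \<open>x\<close>; for matrices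
  in \<open>Rp p e n\<close> every other integer lift gives the same value, see \<open>psi_proj_Hp\<close>.
\<close>

definition psi :: "nat \<Rightarrow> (nat \<Rightarrow> nat) \<Rightarrow> nat \<Rightarrow> int mat \<Rightarrow> (nat \<Rightarrow> int) \<Rightarrow> (nat \<Rightarrow> int)"
  where "psi p e n A = (\<lambda>x\<in>carrier (Hp p e n). proj_Hp p e n (A *\<^sub>v vec n x))"

lemma carrier_Hp:
  assumes "prime p"
  shows "carrier (Hp p e n) = (\<Pi>\<^sub>E i\<in>{..<n}. {0..<int (p ^ e i)})"
proof -
  have "p \<noteq> 0" using assms by auto
  thus ?thesis by (auto simp: Hp_def carrier_integer_mod_group)
qed

lemma proj_Hp_closed:
  assumes "prime p"
  shows "proj_Hp p e n h \<in> carrier (Hp p e n)"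
proof -
  have "p > 0" using assms by (simp add: prime_gt_0_nat)
  thus ?thesis by (auto simp: carrier_Hp[OF assms] proj_Hp_def PiE_def)
qed

lemma proj_Hp_add:
  assumes "g \<in> carrier_vec n" "h \<in> carrier_vec n"
  shows "proj_Hp p e n (g + h) = proj_Hp p e n g \<otimes>\<^bsub>Hp p e n\<^esub> proj_Hp p e n h"
  using assms by (auto simp: proj_Hp_def Hp_def mod_add_eq fun_eq_iff)

lemma proj_Hp_vec:
  assumes "prime p" "x \<in> carrier (Hp p e n)"
  shows "proj_Hp p e n (vec n x) = x"
proof
  fix i
  show "proj_Hp p e n (vec n x) i = x i"
  proof (cases "i < n")
    case True
    then have "x i \<in> {0..<int (p ^ e i)}"
      using assms by (auto simp: carrier_Hp PiE_def Pi_def)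
    thus ?thesis using True by (simp add: proj_Hp_def)
  next
    case False
    thus ?thesis using assms by (auto simp: carrier_Hp proj_Hp_def PiE_def extensional_def)
  qed
qed

lemma proj_Hp_mult_cong:
  assumes e: "mono_on {..<n} e" and A: "A \<in> Rp p e n"
    and g: "g \<in> carrier_vec n" and h: "h \<in> carrier_vec n"
    and eq: "proj_Hp p e n g = proj_Hp p e n h"
  shows "proj_Hp p e n (A *\<^sub>v g) = proj_Hp p e n (A *\<^sub>v h)"
proof
  fix i
  have Ac: "A \<in> carrier_mat n n" using A by (simp add: Rp_def)
  show "proj_Hp p e n (A *\<^sub>v g) i = proj_Hp p e n (A *\<^sub>v h) i"
  proof (cases "i < n")
    case i: True
    have "int p ^ e i dvd A $$ (i, j) * (g $ j - h $ j)" if j: "j < n" for j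
    proof -
      have "g $ j mod int (p ^ e j) = h $ j mod int (p ^ e j)"
        using fun_cong[OF eq, of j] j by (simp add: proj_Hp_def)
      hence d: "int p ^ e j dvd g $ j - h $ j"
        by (simp add: mod_eq_dvd_iff)
      show ?thesis
      proof (cases "j \<le> i")
        case True
        have "e j \<le> e i" using mono_onD[OF e, of j i] True i j by auto
        hence "int p ^ e i = int p ^ (e i - e j) * int p ^ e j"
          by (simp flip: power_add)
        moreover have "int p ^ (e i - e j) dvd A $$ (i, j)"
          using A i True by (auto simp: Rp_def)
        ultimately show ?thesis using d by (simp add: mult_dvd_mono)
      next
        case False
        hence "e i \<le> e j" using mono_onD[OF e, of i j] i j by auto
        hence "int p ^ e i dvd int p ^ e j" by (rule le_imp_power_dvd)
        thus ?thesis using d by (metis dvd_mult dvd_trans)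
      qed
    qed
    hence "int p ^ e i dvd (\<Sum>j = 0..<n. A $$ (i, j) * (g $ j - h $ j))"
      by (intro dvd_sum) auto
    also have "(\<Sum>j = 0..<n. A $$ (i, j) * (g $ j - h $ j)) = (A *\<^sub>v g) $ i - (A *\<^sub>v h) $ i"
      using Ac g h i by (simp add: scalar_prod_def algebra_simps sum_subtractf)
    finally show ?thesis using i by (simp add: proj_Hp_def mod_eq_dvd_iff)
  qed (simp add: proj_Hp_def)
qed

lemma proj_Hp_vec_proj_Hp: "proj_Hp p e n (vec n (proj_Hp p e n h)) = proj_Hp p e n h"
  by (auto simp: proj_Hp_def)

lemma psi_proj_Hp:
  assumes "prime p" "mono_on {..<n} e" "A \<in> Rp p e n" "h \<in> carrier_vec n"
  shows "psi p e n A (proj_Hp p e n h) = proj_Hp p e n (A *\<^sub>v h)"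
  using proj_Hp_mult_cong[OF assms(2,3) vec_carrier assms(4) proj_Hp_vec_proj_Hp]
  by (simp add: psi_def proj_Hp_closed[OF assms(1)])

lemma psi_hom:
  assumes p: "prime p" and e: "mono_on {..<n} e" and A: "A \<in> Rp p e n"
  shows "psi p e n A \<in> hom (Hp p e n) (Hp p e n)"
proof (rule homI)
  fix x assume "x \<in> carrier (Hp p e n)"
  thus "psi p e n A x \<in> carrier (Hp p e n)"
    by (simp add: psi_def proj_Hp_closed[OF p])
next
  fix x y assume x: "x \<in> carrier (Hp p e n)" and y: "y \<in> carrier (Hp p e n)"
  have Ac: "A \<in> carrier_mat n n" using A by (simp add: Rp_def)
  have "x \<otimes>\<^bsub>Hp p e n\<^esub> y = proj_Hp p e n (vec n x + vec n y)"
    by (simp add: proj_Hp_add proj_Hp_vec[OF p] x y)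
  hence "psi p e n A (x \<otimes>\<^bsub>Hp p e n\<^esub> y) = proj_Hp p e n (A *\<^sub>v (vec n x + vec n y))"
    by (simp add: psi_proj_Hp[OF p e A])
  also have "\<dots> = proj_Hp p e n (A *\<^sub>v vec n x + A *\<^sub>v vec n y)"
    by (simp add: mult_add_distrib_mat_vec[OF Ac])
  also have "\<dots> = psi p e n A x \<otimes>\<^bsub>Hp p e n\<^esub> psi p e n A y"
    using x y Ac by (simp add: proj_Hp_add[OF mult_mat_vec_carrier[OF Ac] mult_mat_vec_carrier[OF Ac]] psi_def)
  finally show "psi p e n A (x \<otimes>\<^bsub>Hp p e n\<^esub> y) = psi p e n A x \<otimes>\<^bsub>Hp p e n\<^esub> psi p e n A y" .
qed

text \<open>
  The field with \<open>p\<close> elements is \<open>'p mod_ring\<close> with \<open>CARD('p) = p\<close>, and \<open>of_int\<close> is reduction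
  modulo \<open>p\<close>.
\<close>

definition mat_mod :: "int mat \<Rightarrow> 'p::prime_card mod_ring mat"
  where "mat_mod A = map_mat of_int A"

definition GL :: "'a::field itself \<Rightarrow> nat \<Rightarrow> 'a mat set"
  where "GL F n = Units (ring_mat F n ())"

end

theory Submission
  imports Defs "HOL-Number_Theory.Cong" "Jordan_Normal_Form.Determinant"
begin

text \<open>
  As \<open>H\<^sub>p\<close> is finite, \<open>M\<close> is an automorphism iff it is surjective, and \<open>A\<close> is invertible modulo
  \<open>p\<close> iff \<open>p\<close> does not divide \<open>det A\<close>.  If \<open>M\<close> is surjective, integer lifts of preimages of the
  generators form the columns of a matrix \<open>X\<close> with \<open>A X \<equiv> 1\<close> modulo \<open>p\<close>.  Conversely, if
  \<open>p\<close> does not divide \<open>det A\<close>, then \<open>det A\<close> has an inverse \<open>d\<close> modulo \<open>p\<^sup>N\<close> with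
  \<open>N\<close> at least all \<open>e\<^sub>i\<close>, and \<open>h\<close> is the image under \<open>M\<close> of the class of \<open>adj(A) d h\<close>.
\<close>

lemma mat_mod_carrier [simp]: "A \<in> carrier_mat n m \<Longrightarrow> mat_mod A \<in> carrier_mat n m"
  by (simp add: mat_mod_def)

lemma of_int_mod_ring_eq_iff:
  "(of_int a = (of_int b :: 'p::prime_card mod_ring)) \<longleftrightarrow> [a = b] (mod int CARD('p))"
  by (simp add: of_int_eq_iff_cong_CHAR)

lemma in_GL_iff_det: "B \<in> carrier_mat n n \<Longrightarrow> B \<in> GL TYPE('a::field) n \<longleftrightarrow> det B \<noteq> 0"
  unfolding GL_def by (metis det_non_zero_imp_unit unit_imp_det_non_zero)

lemma det_mat_mod: "det (mat_mod A :: 'p::prime_card mod_ring mat) = of_int (det A)"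
  by (simp add: mat_mod_def)

text \<open>Over a field, invertible means nonzero determinant, and \<open>det\<close> commutes with
  reduction, so invertibility modulo \<open>p\<close> becomes a divisibility condition on one
  integer.\<close>

lemma mat_mod_in_GL_iff:
  assumes "A \<in> carrier_mat n n"
  shows "(mat_mod A :: 'p::prime_card mod_ring mat) \<in> GL TYPE('p mod_ring) n \<longleftrightarrow>
    \<not> int CARD('p) dvd det A"
  using assms of_int_mod_ring_eq_iff[of "det A" 0, where 'p='p]
  by (simp add: in_GL_iff_det det_mat_mod cong_0_iff)

lemma proj_Hp_eq_iff:
  "proj_Hp p e n g = proj_Hp p e n h \<longleftrightarrow> (\<forall>i<n. [g $ i = h $ i] (mod int (p ^ e i)))"
  by (auto simp: proj_Hp_def cong_def fun_eq_iff restrict_def)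

lemma scalar_one_mat_mult_vec:
  assumes "v \<in> carrier_vec n"
  shows "(c \<cdot>\<^sub>m 1\<^sub>m n) *\<^sub>v v = c \<cdot>\<^sub>v (v :: 'a::comm_ring_1 vec)"
  using assms by (intro eq_vecI) auto

lemma finite_carrier_Hp: "prime p \<Longrightarrow> finite (carrier (Hp p e n))"
  by (simp add: carrier_Hp finite_PiE)

text \<open>A surjective self-map of a finite set is injective. \<open>Bij\<close> also demands
  extensionality, which the restriction in \<open>psi\<close> supplies.\<close>

lemma psi_auto_iff_surj:
  assumes p: "prime p" and e: "mono_on {..<n} e" and A: "A \<in> Rp p e n"
  shows "psi p e n A \<in> auto (Hp p e n) \<longleftrightarrow>
    psi p e n A ` carrier (Hp p e n) = carrier (Hp p e n)"
proof -
  have "psi p e n A \<in> extensional (carrier (Hp p e n))"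
    by (simp add: psi_def)
  thus ?thesis
    using psi_hom[OF p e A] finite_carrier_Hp[OF p, of e n]
    by (auto simp: auto_def Bij_def bij_betw_def intro: eq_card_imp_inj_on)
qed

lemma psi_surj_if_not_dvd_det:
  assumes p: "prime p" and e: "mono_on {..<n} e" and A: "A \<in> Rp p e n"
    and det: "\<not> int p dvd det A"
  shows "psi p e n A ` carrier (Hp p e n) = carrier (Hp p e n)"
proof
  show "psi p e n A ` carrier (Hp p e n) \<subseteq> carrier (Hp p e n)"
    using psi_hom[OF p e A] by (auto simp: hom_def)
next
  \<comment> \<open>The sum is a crude common bound for all \<open>e i\<close>, so that one inverse
    \<open>d\<close> modulo \<open>p ^ N\<close> serves every component.\<close>
  define N where "N = (\<Sum>i<n. e i)"
  have Ac: "A \<in> carrier_mat n n" using A by (simp add: Rp_def)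
  note adj = adj_mat(1,2)[OF Ac]
  have "coprime (int p) (det A)"
    using p det by (simp add: prime_imp_coprime)
  hence "coprime (det A) (int p ^ N)"
    by (simp add: ac_simps)
  then obtain d where d: "[det A * d = 1] (mod int p ^ N)"
    using cong_solve_coprime_int by blast
  show "carrier (Hp p e n) \<subseteq> psi p e n A ` carrier (Hp p e n)"
  proof
    fix y assume y: "y \<in> carrier (Hp p e n)"
    define g where "g = adj_mat A *\<^sub>v (d \<cdot>\<^sub>v vec n y)"
    have g: "g \<in> carrier_vec n" using adj by (simp add: g_def)
    have dy: "d \<cdot>\<^sub>v vec n y \<in> carrier_vec n" by simp
    \<comment> \<open>The identity \<open>A * adj_mat A = det A \<cdot>\<^sub>m 1\<^sub>m n\<close>
      holds over the integers, so no division is involved.\<close>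
    have Ag: "A *\<^sub>v g = det A \<cdot>\<^sub>v (d \<cdot>\<^sub>v vec n y)"
      unfolding g_def assoc_mult_mat_vec[OF Ac adj(1) dy, symmetric] adj(2)
      by (rule scalar_one_mat_mult_vec[OF dy])
    have "[(A *\<^sub>v g) $ i = vec n y $ i] (mod int (p ^ e i))" if i: "i < n" for i
    proof -
      have "e i \<le> N" unfolding N_def using i by (intro member_le_sum) auto
      hence "[det A * d = 1] (mod int (p ^ e i))"
        using d by (simp add: cong_dvd_modulus le_imp_power_dvd)
      from cong_mult[OF this cong_refl[of "y i"]] show ?thesis
        using i by (simp add: Ag ac_simps)
    qed
    hence "psi p e n A (proj_Hp p e n g) = proj_Hp p e n (vec n y)"
      by (simp add: psi_proj_Hp[OF p e A g] proj_Hp_eq_iff)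
    hence "psi p e n A (proj_Hp p e n g) = y"
      by (simp add: proj_Hp_vec[OF p y])
    thus "y \<in> psi p e n A ` carrier (Hp p e n)"
      using proj_Hp_closed[OF p] by (metis imageI)
  qed
qed

lemma mat_mod_in_GL_if_psi_surj:
  assumes p: "prime p" and card: "CARD('p::prime_card) = p"
    and e1: "\<And>i. i < n \<Longrightarrow> 1 \<le> e i" and A: "A \<in> carrier_mat n n"
    and surj: "psi p e n A ` carrier (Hp p e n) = carrier (Hp p e n)"
  shows "(mat_mod A :: 'p mod_ring mat) \<in> GL TYPE('p mod_ring) n"
proof -
  \<comment> \<open>A preimage of the class of a unit vector, read through its canonical
    representatives, is an integer vector: column \<open>k\<close> of \<open>X\<close> when
    \<open>k < n\<close>.\<close>
  have "\<exists>x. proj_Hp p e n (A *\<^sub>v vec n x) = proj_Hp p e n (unit_vec n k)" for k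
  proof -
    have "proj_Hp p e n (unit_vec n k) \<in> psi p e n A ` carrier (Hp p e n)"
      unfolding surj by (rule proj_Hp_closed[OF p])
    thus ?thesis by (auto simp: psi_def)
  qed
  then obtain x where
    x: "\<And>k. proj_Hp p e n (A *\<^sub>v vec n (x k)) = proj_Hp p e n (unit_vec n k)"
    by metis
  define X where "X = mat n n (\<lambda>(i, k). x k i)"
  have X: "X \<in> carrier_mat n n" by (simp add: X_def)
  have "mat_mod A * mat_mod X = (1\<^sub>m n :: 'p mod_ring mat)"
  proof (rule eq_matI)
    fix i k assume "i < dim_row (1\<^sub>m n :: 'p mod_ring mat)" "k < dim_col (1\<^sub>m n :: 'p mod_ring mat)"
    hence ik: "i < n" "k < n" by auto
    have "col X k = vec n (x k)" using ik by (auto simp: X_def)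
    hence "(A * X) $$ (i, k) = (A *\<^sub>v vec n (x k)) $ i"
      using A X ik by simp
    moreover have "[(A *\<^sub>v vec n (x k)) $ i = (if i = k then 1 else 0)] (mod int (p ^ e i))"
      using x[of k] ik by (auto simp: proj_Hp_eq_iff)
    \<comment> \<open>Row \<open>i\<close> is known modulo \<open>p ^ e i\<close> only; as
      \<open>e i \<ge> 1\<close>, all rows descend to the common modulus \<open>p\<close>.\<close>
    moreover have "int p dvd int (p ^ e i)"
      using e1[OF ik(1)] by (simp add: dvd_power)
    ultimately have "[(A * X) $$ (i, k) = (if i = k then 1 else 0)] (mod int CARD('p))"
      unfolding card by (metis cong_dvd_modulus)
    hence "of_int ((A * X) $$ (i, k)) = (of_int (if i = k then 1 else 0) :: 'p mod_ring)"
      by (simp only: of_int_mod_ring_eq_iff)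
    moreover have "mat_mod A * mat_mod X = (mat_mod (A * X) :: 'p mod_ring mat)"
      unfolding mat_mod_def by (rule of_int_hom.mat_hom_mult[OF A X, symmetric])
    ultimately show "(mat_mod A * mat_mod X) $$ (i, k) = (1\<^sub>m n :: 'p mod_ring mat) $$ (i, k)"
      using A X ik by (simp add: mat_mod_def)
  qed (use A X in \<open>auto simp: mat_mod_def\<close>)
  \<comment> \<open>Determinants turn the one-sided inverse into invertibility.\<close>
  hence "det (mat_mod A) * det (mat_mod X) = (1 :: 'p mod_ring)"
    using A X by (metis det_mult det_one mat_mod_carrier)
  hence "det (mat_mod A :: 'p mod_ring mat) \<noteq> 0" by auto
  thus ?thesis using A by (simp add: in_GL_iff_det)
qed

theorem theorem3p6:
  fixes p n :: nat and e :: "nat \<Rightarrow> nat" and A :: "int mat"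
    and M :: "(nat \<Rightarrow> int) \<Rightarrow> (nat \<Rightarrow> int)"
  assumes "prime p"
    and "CARD('p::prime_card) = p"
    and "\<And>i. i < n \<Longrightarrow> 1 \<le> e i"
    and "mono_on {..<n} e"
    and "A \<in> Rp p e n"
    and "M = psi p e n A"
  shows "M \<in> auto (Hp p e n) \<longleftrightarrow> (mat_mod A :: 'p mod_ring mat) \<in> GL TYPE('p mod_ring) n"
proof -
  have A: "A \<in> carrier_mat n n" using assms(5) by (simp add: Rp_def)
  have "M \<in> auto (Hp p e n) \<longleftrightarrow> M ` carrier (Hp p e n) = carrier (Hp p e n)"
    unfolding assms(6) by (rule psi_auto_iff_surj[OF assms(1,4,5)])
  also have "\<dots> \<longleftrightarrow> (mat_mod A :: 'p mod_ring mat) \<in> GL TYPE('p mod_ring) n"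
    using mat_mod_in_GL_if_psi_surj[OF assms(1,2) _ A, of e] assms(3)
      psi_surj_if_not_dvd_det[OF assms(1,4,5)] mat_mod_in_GL_iff[OF A, where 'p='p]
    unfolding assms(2,6) by blast
  finally show ?thesis .
qed

end
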